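(* Let $M\ge1$, let $\Delta\in\mathbb R^{M\times M}$ be a nonzero symmetric positive semi-definite matrix, let $\theta>0$, and set $\theta'=\theta/\|\Delta\|$. For $\mu_{\max}>0$ let $\boldsymbol d\sim\mathcal N(0,\mu_{\max}\Delta)$ in $\mathbb R^M$ and $\boldsymbol\delta^2=\|\boldsymbol d\|^2$. Then for all $0<\mu_{\max}<\theta'/M$, $$\Pr[\boldsymbol\delta^2>\theta]\le\left(\frac{\theta' e}{\mu_{\max}M}\right)^{M/2}\exp\left(-\frac{\theta'}{2\mu_{\max}}\right).$$ Consequently, this probability (the Type-I error, or false alarm, probability) is $O(e^{-c_1/\mu_{\max}})$ as $\mu_{\max}\to0$ for some constant $c_1>0$.
   Context: Here $\boldsymbol d=\boldsymbol w_{k,i}-\boldsymbol w_{\ell,i}$ models, in steady state, the difference of the estimates of two agents $k,\ell$ from different groups, under the hypothesis $\mathbb H_0$ that both agents belong to the same cluster (so that they have the same minimizer and the difference has zero mean). The hypothesis test accepts $\mathbb H_0$ when $\boldsymbol\delta^2<\theta$ and rejects it when $\boldsymbol\delta^2>\theta$, so the Type-I error probability is $\Pr[\boldsymbol\delta^2>\theta]$ under $\mathbb H_0$. $\|\Delta\|$ is the induced 2-norm, $e$ is Euler's number, and $\mathcal N(a,B)$ is the Gaussian law with mean $a$ and covariance $B$. The matrix $\Delta$ and threshold $\theta$ do not depend on $\mu_{\max}$. *)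

theory Defs
  imports "HOL-Probability.Probability"
begin

definition sym_psd :: "real^'m^'m \<Rightarrow> bool" where
  "sym_psd B \<longleftrightarrow> transpose B = B \<and> (\<forall>x. 0 \<le> x \<bullet> (B *v x))"

(* Univariate normal law with mean m and variance v; the second parameter of normal_density
   is the standard deviation.  Variance 0 gives the Dirac law at m. *)
definition normal_law :: "real \<Rightarrow> real \<Rightarrow> real measure" where
  "normal_law m v =
     (if v = 0 then return borel m else density lborel (\<lambda>x. ennreal (normal_density m (sqrt v) x)))"

(* X has the law N(a, B): every linear functional of X is univariate normal, with the mean and
   variance prescribed by a and B.  B may be singular, so there need not be a Lebesgue density. *)
definition gaussian_vector ::
    "'a measure \<Rightarrow> ('a \<Rightarrow> real^'m) \<Rightarrow> real^'m \<Rightarrow> real^'m^'m \<Rightarrow> bool" where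
  "gaussian_vector P X a B \<longleftrightarrow>
     prob_space P \<and> X \<in> borel_measurable P \<and> sym_psd B \<and>
     (\<forall>u. distr P borel (\<lambda>\<omega>. u \<bullet> X \<omega>) = normal_law (u \<bullet> a) (u \<bullet> (B *v u)))"

end

theory Submission
  imports Defs "HOL-Real_Asymp.Real_Asymp"
begin

text \<open>
  The bound is Chernoff's, applied to the squared norm of a Gaussian vector \<open>X\<close> in dimension \<open>M\<close> with mean \<open>0\<close>
  and covariance \<open>B\<close>.  The point is to estimate the exponential moment \<open>E exp (t |X|\<^sup>2)\<close> knowing only
  the laws of the linear functionals \<open>u \<bullet> X\<close>, without diagonalising \<open>B\<close> and without a density
  for \<open>X\<close>.  To this end the square is linearised: if \<open>g\<close> has independent standard normal
  coordinates, then \<open>exp (t |x|\<^sup>2) = E exp (sqrt (2 t) (g \<bullet> x))\<close> for every \<open>x\<close>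
  (\<open>nn_integral_exp_linear_std_normal_vector\<close>).  Exchanging the two expectations, the inner one
  becomes the moment generating function of a univariate normal variable, so that

  \<open>E exp (t |X|\<^sup>2) = E exp (t (g \<bullet> B g)) \<le> E exp (t K |g|\<^sup>2) = (1 - 2 t K) powr (- M / 2)\<close>

  whenever \<open>K\<close> bounds the quadratic form of \<open>B\<close> and \<open>2 t K < 1\<close>
  (\<open>gaussian_vector_nn_integral_exp_norm_le\<close>).  For \<open>B = \<mu> \<Delta>\<close> one takes \<open>K = \<mu> |\<Delta>|\<close>, and
  the Markov inequality at the optimal \<open>t\<close>, given by \<open>1 - 2 t K = \<mu> M / \<theta>'\<close>, is the stated
  estimate.  Its polynomial factor \<open>\<mu> powr (- M / 2)\<close> is absorbed by giving up half of the exponent,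
  so \<open>c\<^sub>1 = \<theta>' / 4\<close> works.
\<close>

section \<open>Exponential moments of univariate normal laws\<close>

lemma nn_integral_normal_density:
  assumes "\<sigma> > 0"
  shows "(\<integral>\<^sup>+x. ennreal (normal_density m \<sigma> x) \<partial>lborel) = 1"
  using assms by (subst nn_integral_eq_integral)
    (auto simp: integrable_normal_density integral_normal_density)

text \<open>Completing the square: tilting a centred normal density by \<open>exp (a x)\<close> only moves its mean,
  to \<open>a \<sigma>\<^sup>2\<close>.\<close>

lemma nn_integral_exp_normal_density:
  assumes "\<sigma> > 0"
  shows "(\<integral>\<^sup>+x. ennreal (normal_density 0 \<sigma> x) * ennreal (exp (a * x)) \<partial>lborel)
    = ennreal (exp (a\<^sup>2 * \<sigma>\<^sup>2 / 2))"
proof -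
  have "normal_density 0 \<sigma> x * exp (a * x)
      = exp (a\<^sup>2 * \<sigma>\<^sup>2 / 2) * normal_density (a * \<sigma>\<^sup>2) \<sigma> x" for x
  proof -
    have "- x\<^sup>2 / (2 * \<sigma>\<^sup>2) + a * x = a\<^sup>2 * \<sigma>\<^sup>2 / 2 + - (x - a * \<sigma>\<^sup>2)\<^sup>2 / (2 * \<sigma>\<^sup>2)"
      using assms by (simp add: field_simps power2_eq_square)
    then have "exp (- x\<^sup>2 / (2 * \<sigma>\<^sup>2)) * exp (a * x)
        = exp (a\<^sup>2 * \<sigma>\<^sup>2 / 2) * exp (- (x - a * \<sigma>\<^sup>2)\<^sup>2 / (2 * \<sigma>\<^sup>2))"
      by (metis exp_add)
    then show ?thesis by (simp add: normal_density_def)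
  qed
  then have "(\<integral>\<^sup>+x. ennreal (normal_density 0 \<sigma> x) * ennreal (exp (a * x)) \<partial>lborel)
      = (\<integral>\<^sup>+x. ennreal (exp (a\<^sup>2 * \<sigma>\<^sup>2 / 2)) * ennreal (normal_density (a * \<sigma>\<^sup>2) \<sigma> x) \<partial>lborel)"
    by (simp flip: ennreal_mult')
  also have "\<dots> = ennreal (exp (a\<^sup>2 * \<sigma>\<^sup>2 / 2))"
    using assms by (simp add: nn_integral_cmult nn_integral_normal_density)
  finally show ?thesis .
qed

text \<open>Tilting the standard normal density by \<open>exp (b x\<^sup>2)\<close> only changes its variance, to
  \<open>1 / (1 - 2 b)\<close>.\<close>

lemma nn_integral_exp_square_std_normal_density:
  assumes "2 * b < 1"
  shows "(\<integral>\<^sup>+x. ennreal (std_normal_density x) * ennreal (exp (b * x\<^sup>2)) \<partial>lborel)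
    = ennreal ((1 - 2 * b) powr (- 1 / 2))"
proof -
  define \<sigma> where "\<sigma> = (1 - 2 * b) powr (- 1 / 2)"
  have \<sigma>: "\<sigma> > 0" using assms by (simp add: \<sigma>_def)
  have \<sigma>2: "\<sigma>\<^sup>2 = 1 / (1 - 2 * b)"
  proof -
    have "\<sigma>\<^sup>2 = (1 - 2 * b) powr (- 1)"
      unfolding \<sigma>_def power2_eq_square by (simp flip: powr_add)
    then show ?thesis using assms by (simp add: powr_minus_divide)
  qed
  have "std_normal_density x * exp (b * x\<^sup>2) = \<sigma> * normal_density 0 \<sigma> x" for x
  proof -
    have "- x\<^sup>2 / 2 + b * x\<^sup>2 = - x\<^sup>2 / (2 * \<sigma>\<^sup>2)"
      using assms by (simp add: \<sigma>2 field_simps)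
    then have "exp (- x\<^sup>2 / 2) * exp (b * x\<^sup>2) = exp (- x\<^sup>2 / (2 * \<sigma>\<^sup>2))"
      by (metis exp_add)
    then show ?thesis using \<sigma>
      by (simp add: normal_density_def real_sqrt_mult)
  qed
  then have "(\<integral>\<^sup>+x. ennreal (std_normal_density x) * ennreal (exp (b * x\<^sup>2)) \<partial>lborel)
      = (\<integral>\<^sup>+x. ennreal \<sigma> * ennreal (normal_density 0 \<sigma> x) \<partial>lborel)"
    using \<sigma> by (simp flip: ennreal_mult')
  also have "\<dots> = ennreal \<sigma>"
    using \<sigma> by (simp add: nn_integral_cmult nn_integral_normal_density)
  finally show ?thesis by (simp add: \<sigma>_def)
qed

lemma nn_integral_exp_normal_law:
  assumes "v \<ge> 0"
  shows "(\<integral>\<^sup>+x. ennreal (exp (a * x)) \<partial>normal_law 0 v) = ennreal (exp (a\<^sup>2 * v / 2))"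
proof (cases "v = 0")
  case True
  then show ?thesis by (simp add: normal_law_def nn_integral_return)
next
  case False
  then have "sqrt v > 0" using assms by simp
  from nn_integral_exp_normal_density[OF this, of a] show ?thesis
    using False assms by (simp add: normal_law_def nn_integral_density)
qed

section \<open>Vectors of independent standard normal variables\<close>

definition std_normal_vector :: "('m::finite \<Rightarrow> real) measure" where
  "std_normal_vector = PiM UNIV (\<lambda>_. density lborel (\<lambda>x. ennreal (std_normal_density x)))"

lemma prob_space_std_normal_vector: "prob_space std_normal_vector"
  unfolding std_normal_vector_def
  by (intro prob_space_PiM prob_space_normal_density) simp

lemma measurable_std_normal_vector [measurable]:
  "(\<lambda>g. g i) \<in> borel_measurable (std_normal_vector :: ('m::finite \<Rightarrow> real) measure)"
proof -
  have "(\<lambda>g. g i) \<in> measurable (std_normal_vector :: ('m \<Rightarrow> real) measure)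
      (density lborel (\<lambda>x. ennreal (std_normal_density x)))"
    unfolding std_normal_vector_def by (rule measurable_component_singleton) simp
  then show ?thesis by simp
qed

lemma nn_integral_prod_std_normal_vector:
  fixes f :: "'m::finite \<Rightarrow> real \<Rightarrow> ennreal"
  assumes "\<And>i. f i \<in> borel_measurable borel"
  shows "(\<integral>\<^sup>+g. (\<Prod>i\<in>UNIV. f i (g i)) \<partial>std_normal_vector)
    = (\<Prod>i\<in>UNIV. \<integral>\<^sup>+x. ennreal (std_normal_density x) * f i x \<partial>lborel)"
proof -
  let ?N = "\<lambda>_::'m. density lborel (\<lambda>x. ennreal (std_normal_density x))"
  interpret N: product_prob_space ?N UNIV
    by (intro product_prob_spaceI prob_space_normal_density) simp
  have "(\<integral>\<^sup>+g. (\<Prod>i\<in>UNIV. f i (g i)) \<partial>std_normal_vector) = (\<Prod>i\<in>UNIV. integral\<^sup>N (?N i) (f i))"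
    unfolding std_normal_vector_def
    by (rule N.product_nn_integral_prod) (use assms in auto)
  also have "\<dots> = (\<Prod>i\<in>UNIV. \<integral>\<^sup>+x. ennreal (std_normal_density x) * f i x \<partial>lborel)"
    using assms by (intro prod.cong refl nn_integral_density) auto
  finally show ?thesis .
qed

lemma nn_integral_exp_linear_std_normal_vector:
  fixes x :: "real^'m"
  shows "(\<integral>\<^sup>+g. ennreal (exp (s * ((\<chi> i. g i) \<bullet> x))) \<partial>std_normal_vector)
    = ennreal (exp (s\<^sup>2 / 2 * (norm x)\<^sup>2))"
proof -
  have "(\<integral>\<^sup>+g. ennreal (exp (s * ((\<chi> i. g i) \<bullet> x))) \<partial>std_normal_vector)
      = (\<integral>\<^sup>+g. (\<Prod>i\<in>UNIV. ennreal (exp (s * x $ i * g i))) \<partial>std_normal_vector)"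
    by (intro nn_integral_cong)
      (simp add: inner_vec_def sum_distrib_left exp_sum prod_ennreal mult_ac)
  also have "\<dots> = (\<Prod>i\<in>UNIV. ennreal (exp ((s * x $ i)\<^sup>2 / 2)))"
    by (subst nn_integral_prod_std_normal_vector)
      (auto simp: nn_integral_exp_normal_density)
  also have "\<dots> = ennreal (exp (s\<^sup>2 / 2 * (norm x)\<^sup>2))"
    unfolding power2_norm_eq_inner
    by (simp add: prod_ennreal inner_vec_def sum_distrib_left power_mult_distrib
        power2_eq_square mult_ac flip: exp_sum)
  finally show ?thesis .
qed

lemma nn_integral_exp_norm_std_normal_vector:
  assumes "2 * b < 1"
  shows "(\<integral>\<^sup>+g. ennreal (exp (b * (norm (\<chi> i. g i :: real^'m))\<^sup>2)) \<partial>std_normal_vector)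
    = ennreal ((1 - 2 * b) powr (- real CARD('m) / 2))"
proof -
  have "(\<integral>\<^sup>+g. ennreal (exp (b * (norm (\<chi> i. g i :: real^'m))\<^sup>2)) \<partial>std_normal_vector)
      = (\<integral>\<^sup>+g. (\<Prod>i\<in>(UNIV::'m set). ennreal (exp (b * (g i)\<^sup>2))) \<partial>std_normal_vector)"
    unfolding power2_norm_eq_inner
    by (intro nn_integral_cong)
      (simp add: inner_vec_def sum_distrib_left exp_sum prod_ennreal power2_eq_square)
  also have "\<dots> = (\<Prod>i\<in>(UNIV::'m set). ennreal ((1 - 2 * b) powr (- 1 / 2)))"
    by (subst nn_integral_prod_std_normal_vector)
      (auto simp: nn_integral_exp_square_std_normal_density[OF assms])
  also have "\<dots> = ennreal ((1 - 2 * b) powr (- real CARD('m) / 2))"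
    using assms by (simp add: ennreal_power powr_power)
  finally show ?thesis .
qed

section \<open>Exponential moments and tails of Gaussian vectors\<close>

lemma gaussian_vector_nn_integral_exp_inner:
  assumes "gaussian_vector P X 0 B"
  shows "(\<integral>\<^sup>+\<omega>. ennreal (exp (s * (u \<bullet> X \<omega>))) \<partial>P) = ennreal (exp (s\<^sup>2 / 2 * (u \<bullet> (B *v u))))"
proof -
  have [measurable]: "X \<in> borel_measurable P" and "0 \<le> u \<bullet> (B *v u)"
    and law: "distr P borel (\<lambda>\<omega>. u \<bullet> X \<omega>) = normal_law 0 (u \<bullet> (B *v u))"
    using assms by (auto simp: gaussian_vector_def sym_psd_def)
  have "(\<integral>\<^sup>+\<omega>. ennreal (exp (s * (u \<bullet> X \<omega>))) \<partial>P)
      = (\<integral>\<^sup>+x. ennreal (exp (s * x)) \<partial>distr P borel (\<lambda>\<omega>. u \<bullet> X \<omega>))"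
    by (subst nn_integral_distr) auto
  also have "\<dots> = ennreal (exp (s\<^sup>2 / 2 * (u \<bullet> (B *v u))))"
    using \<open>0 \<le> u \<bullet> (B *v u)\<close> by (simp add: law nn_integral_exp_normal_law)
  finally show ?thesis .
qed

text \<open>Linearising the square by an auxiliary standard normal vector leaves, after the exchange of
  the integrals, only the exponential moments of linear functionals of \<open>X\<close>.  The bound on the
  quadratic form then replaces \<open>B\<close> by a multiple of the identity.\<close>

lemma gaussian_vector_nn_integral_exp_norm_le:
  fixes X :: "'a \<Rightarrow> real^'m"
  assumes X: "gaussian_vector P X 0 B"
    and le: "\<And>u. u \<bullet> (B *v u) \<le> K * (norm u)\<^sup>2"
    and t: "0 \<le> t" "2 * (t * K) < 1"
  shows "(\<integral>\<^sup>+\<omega>. ennreal (exp (t * (norm (X \<omega>))\<^sup>2)) \<partial>P)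
    \<le> ennreal ((1 - 2 * (t * K)) powr (- real CARD('m) / 2))"
proof -
  have [measurable]: "X \<in> borel_measurable P" and P: "prob_space P"
    using X by (auto simp: gaussian_vector_def)
  interpret P: prob_space P by (rule P)
  interpret G: prob_space "std_normal_vector :: ('m \<Rightarrow> real) measure"
    by (rule prob_space_std_normal_vector)
  interpret PG: pair_sigma_finite P "std_normal_vector :: ('m \<Rightarrow> real) measure" ..
  have [measurable]: "(\<lambda>\<omega>. X \<omega> $ i) \<in> borel_measurable P" for i
    by (simp add: cart_eq_inner_axis)
  have s: "(sqrt (2 * t))\<^sup>2 / 2 = t" using t by simp
  have "(\<integral>\<^sup>+\<omega>. ennreal (exp (t * (norm (X \<omega>))\<^sup>2)) \<partial>P)
      = (\<integral>\<^sup>+\<omega>. \<integral>\<^sup>+g. ennreal (exp (sqrt (2 * t) * ((\<chi> i. g i) \<bullet> X \<omega>))) \<partial>std_normal_vector \<partial>P)"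
    by (simp only: nn_integral_exp_linear_std_normal_vector s)
  also have "\<dots> = (\<integral>\<^sup>+g. \<integral>\<^sup>+\<omega>. ennreal (exp (sqrt (2 * t) * ((\<chi> i. g i) \<bullet> X \<omega>))) \<partial>P
      \<partial>std_normal_vector)"
    by (rule PG.Fubini'[symmetric]) (unfold inner_vec_def split_beta', simp, measurable)
  also have "\<dots> = (\<integral>\<^sup>+g. ennreal (exp (t * ((\<chi> i. g i) \<bullet> (B *v (\<chi> i. g i))))) \<partial>std_normal_vector)"
    by (simp only: gaussian_vector_nn_integral_exp_inner[OF X] s)
  also have "\<dots> \<le> (\<integral>\<^sup>+g. ennreal (exp (t * K * (norm (\<chi> i. g i :: real^'m))\<^sup>2)) \<partial>std_normal_vector)"
    using t(1) by (intro nn_integral_mono ennreal_leI)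
      (simp add: mult.assoc mult_left_mono le)
  also have "\<dots> = ennreal ((1 - 2 * (t * K)) powr (- real CARD('m) / 2))"
    using t(2) by (rule nn_integral_exp_norm_std_normal_vector)
  finally show ?thesis .
qed

lemma gaussian_vector_norm_tail_le:
  fixes X :: "'a \<Rightarrow> real^'m"
  assumes X: "gaussian_vector P X 0 B"
    and le: "\<And>u. u \<bullet> (B *v u) \<le> K * (norm u)\<^sup>2"
    and t: "0 \<le> t" "2 * (t * K) < 1"
  shows "\<P>(\<omega> in P. (norm (X \<omega>))\<^sup>2 > \<theta>)
    \<le> exp (- t * \<theta>) * (1 - 2 * (t * K)) powr (- real CARD('m) / 2)"
proof -
  have [measurable]: "X \<in> borel_measurable P" and P: "prob_space P"
    using X by (auto simp: gaussian_vector_def)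
  interpret P: prob_space P by (rule P)
  have "ennreal \<P>(\<omega> in P. (norm (X \<omega>))\<^sup>2 > \<theta>)
      = (\<integral>\<^sup>+\<omega>. indicator {\<omega> \<in> space P. (norm (X \<omega>))\<^sup>2 > \<theta>} \<omega> \<partial>P)"
    by (simp add: P.emeasure_eq_measure)
  also have "\<dots> \<le> (\<integral>\<^sup>+\<omega>. ennreal (exp (- t * \<theta>)) * ennreal (exp (t * (norm (X \<omega>))\<^sup>2)) \<partial>P)"
  proof (intro nn_integral_mono)
    fix \<omega>
    have "1 \<le> exp (- t * \<theta>) * exp (t * (norm (X \<omega>))\<^sup>2)" if "(norm (X \<omega>))\<^sup>2 > \<theta>"
      using that t(1) by (simp add: mult_left_mono flip: exp_add)
    then show "indicator {\<omega> \<in> space P. (norm (X \<omega>))\<^sup>2 > \<theta>} \<omega>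
        \<le> ennreal (exp (- t * \<theta>)) * ennreal (exp (t * (norm (X \<omega>))\<^sup>2))"
      by (auto simp: indicator_def simp flip: ennreal_mult')
  qed
  also have "\<dots> = ennreal (exp (- t * \<theta>)) * (\<integral>\<^sup>+\<omega>. ennreal (exp (t * (norm (X \<omega>))\<^sup>2)) \<partial>P)"
    by (rule nn_integral_cmult) simp
  also have "\<dots> \<le> ennreal (exp (- t * \<theta>)) * ennreal ((1 - 2 * (t * K)) powr (- real CARD('m) / 2))"
    by (intro mult_left_mono gaussian_vector_nn_integral_exp_norm_le[OF X le t]) simp
  also have "\<dots> = ennreal (exp (- t * \<theta>) * (1 - 2 * (t * K)) powr (- real CARD('m) / 2))"
    by (simp add: ennreal_mult')
  finally show ?thesis by (subst (asm) ennreal_le_iff) auto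
qed

section \<open>The false alarm probability\<close>

lemma quadratic_form_le_onorm:
  fixes A :: "real^'m^'m"
  shows "u \<bullet> (A *v u) \<le> onorm (\<lambda>x. A *v x) * (norm u)\<^sup>2"
proof -
  have "u \<bullet> (A *v u) \<le> norm u * norm (A *v u)" by (rule norm_cauchy_schwarz)
  also have "\<dots> \<le> norm u * (onorm (\<lambda>x. A *v x) * norm u)"
    by (intro mult_left_mono onorm matrix_vector_mul_bounded_linear) simp
  finally show ?thesis by (simp add: power2_eq_square mult_ac)
qed

theorem mainTheorem7:
  fixes \<Delta> :: "real^'m^'m"
    and \<theta> \<theta>' :: real
    and P :: "real \<Rightarrow> 'a measure"
    and d :: "real \<Rightarrow> 'a \<Rightarrow> real^'m"
  assumes "sym_psd \<Delta>" and "\<Delta> \<noteq> 0" and "\<theta> > 0"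
    and "\<theta>' = \<theta> / onorm (\<lambda>x. \<Delta> *v x)"
    and "\<And>\<mu>. \<mu> > 0 \<Longrightarrow> gaussian_vector (P \<mu>) (d \<mu>) 0 (\<mu> *\<^sub>R \<Delta>)"
  shows "(\<forall>\<mu>. 0 < \<mu> \<and> \<mu> < \<theta>' / real CARD('m) \<longrightarrow>
            \<P>(\<omega> in P \<mu>. (norm (d \<mu> \<omega>))\<^sup>2 > \<theta>)
              \<le> (\<theta>' * exp 1 / (\<mu> * real CARD('m))) powr (real CARD('m) / 2) * exp (- \<theta>' / (2 * \<mu>)))
       \<and> (\<exists>c\<^sub>1>0. (\<lambda>\<mu>. \<P>(\<omega> in P \<mu>. (norm (d \<mu> \<omega>))\<^sup>2 > \<theta>))
                     \<in> O[at_right 0](\<lambda>\<mu>. exp (- c\<^sub>1 / \<mu>)))"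
proof -
  define L where "L = onorm (\<lambda>x. \<Delta> *v x)"
  define M where "M = real CARD('m)"
  have M: "M > 0" by (simp add: M_def)
  have L: "L > 0"
  proof -
    have "\<exists>x. \<Delta> *v x \<noteq> 0"
      using \<open>\<Delta> \<noteq> 0\<close> matrix_eq[of \<Delta> 0] by auto
    then show ?thesis
      using onorm_pos_lt[OF matrix_vector_mul_bounded_linear[of \<Delta>]] by (auto simp: L_def)
  qed
  have \<theta>: "\<theta> = \<theta>' * L" and \<theta>': "\<theta>' > 0"
    using assms(3,4) L by (auto simp: L_def)
  have bound: "\<P>(\<omega> in P \<mu>. (norm (d \<mu> \<omega>))\<^sup>2 > \<theta>)
      \<le> (\<theta>' * exp 1 / (\<mu> * M)) powr (M / 2) * exp (- \<theta>' / (2 * \<mu>))"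
    if \<mu>: "0 < \<mu>" "\<mu> < \<theta>' / M" for \<mu>
  proof -
    define q where "q = \<mu> * M / \<theta>'"
    \<comment> \<open>the minimiser of the Chernoff bound, characterised by \<open>1 - 2 t (\<mu> L) = q\<close>\<close>
    define t where "t = (1 - q) / (2 * \<mu> * L)"
    have q: "0 < q" "q < 1" using \<mu> M \<theta>' by (auto simp: q_def field_simps)
    have t: "0 \<le> t" and tq: "1 - 2 * (t * (\<mu> * L)) = q"
      using q \<mu> L by (auto simp: t_def field_simps)
    have le: "u \<bullet> ((\<mu> *\<^sub>R \<Delta>) *v u) \<le> \<mu> * L * (norm u)\<^sup>2" for u
      using quadratic_form_le_onorm[of u \<Delta>] \<mu>
      by (simp add: L_def scaleR_matrix_vector_assoc[symmetric])
    have "\<P>(\<omega> in P \<mu>. (norm (d \<mu> \<omega>))\<^sup>2 > \<theta>) \<le> exp (- t * \<theta>) * q powr (- M / 2)"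
      using gaussian_vector_norm_tail_le[OF assms(5)[OF \<mu>(1)] le t, of \<theta>] tq q
      by (simp add: M_def)
    also have "- t * \<theta> = M / 2 - \<theta>' / (2 * \<mu>)"
      using \<mu> L \<theta>' by (simp add: t_def q_def \<theta> field_simps)
    also have "exp (M / 2 - \<theta>' / (2 * \<mu>)) * q powr (- M / 2)
        = (exp 1 / q) powr (M / 2) * exp (- \<theta>' / (2 * \<mu>))"
      using q by (simp add: powr_def ln_div algebra_simps flip: exp_add)
    also have "exp 1 / q = \<theta>' * exp 1 / (\<mu> * M)" by (simp add: q_def)
    finally show ?thesis .
  qed
  have "(\<lambda>\<mu>. \<P>(\<omega> in P \<mu>. (norm (d \<mu> \<omega>))\<^sup>2 > \<theta>))
      \<in> O[at_right 0](\<lambda>\<mu>. (\<theta>' * exp 1 / (\<mu> * M)) powr (M / 2) * exp (- \<theta>' / (2 * \<mu>)))"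
  proof (rule bigoI[of _ 1])
    have "eventually (\<lambda>\<mu>. \<mu> \<in> {0<..<\<theta>' / M}) (at_right 0)"
      using \<theta>' M by (intro eventually_at_right_real) simp
    then show "\<forall>\<^sub>F \<mu> in at_right 0. norm \<P>(\<omega> in P \<mu>. (norm (d \<mu> \<omega>))\<^sup>2 > \<theta>)
        \<le> 1 * norm ((\<theta>' * exp 1 / (\<mu> * M)) powr (M / 2) * exp (- \<theta>' / (2 * \<mu>)))"
      by eventually_elim (use bound in auto)
  qed
  also have "(\<lambda>\<mu>. (\<theta>' * exp 1 / (\<mu> * M)) powr (M / 2) * exp (- \<theta>' / (2 * \<mu>)))
      \<in> O[at_right 0](\<lambda>\<mu>. exp (- (\<theta>' / 4) / \<mu>))"
    using M \<theta>' by real_asymp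
  finally have "(\<lambda>\<mu>. \<P>(\<omega> in P \<mu>. (norm (d \<mu> \<omega>))\<^sup>2 > \<theta>)) \<in> O[at_right 0](\<lambda>\<mu>. exp (- (\<theta>' / 4) / \<mu>))" .
  moreover have "\<theta>' / 4 > 0" using \<theta>' by simp
  ultimately show ?thesis using bound unfolding M_def by blast
qed

end
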